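(* Let $f(X)=\sum_{i=0}^n a_iX^i\in A[X;\sigma,\delta]$ be monic of degree $n$, and let $\mathcal{C}$ be a principal $(f,\sigma,\delta)$-code of length $n$ generated by some monic $g(X)\in A[X;\sigma,\delta]$ of degree $n-k$ (a right divisor of $f$) which is also a left divisor of $f(X)$, with $f(X)=g(X)h(X)$ for some $h(X)=\sum_{i=0}^k h_iX^i\in A[X;\sigma,\delta]$. Then a control matrix $H\in M_{n,n}(A)$ of $\mathcal{C}$ is given by $$\left( \begin{array}{ccccccc} h_0 & \dots & h_{k} & 0& 0 &\dots & 0\\ h_0^{(1)} & \dots & h_{k}^{(1)} & \sigma(h_{k}) & 0 & \dots & 0\\ h_0^{(2)} & \dots & h_{k}^{(2)} & h_{k+1}^{(2)} & \sigma^2(h_{k}) & \dots & 0\\ \vdots & \vdots & \vdots & \vdots & \vdots & \vdots & \vdots \\ h_0^{(n-k-1)} & \dots & h_{k}^{(n-k-1)} & h_{k+1}^{(n-k-1)} & h_{k+2}^{(n-k-1)} & \dots & \sigma^{n-k-1}(h_{k})\\ h_0^{(n-k)} & \dots & h_{k}^{(n-k)} & h_{k+1}^{(n-k)} & h_{k+2}^{(n-k)} & \dots & h_{n-1}^{(n-k)}\\ \vdots & \vdots & \vdots & \vdots & \vdots & \vdots & \vdots \\ h_0^{(n-1)} & \dots & h_{k}^{(n-1)} & h_{k+1}^{(n-1)} & h_{k+2}^{(n-1)} & \dots & h_{n-1}^{(n-1)} \end{array} \right),$$ where (1) $h_i=0$ for $k+1\le i\le n-1$; (2) for $1\le i\le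 n-k-1$ and $1\le j\le n-2$: (i) $h_0^{(i)}=\delta(h_0^{(i-1)})$, (ii) $h_j^{(i)}=\delta(h_j^{(i-1)})+\sigma(h_{j-1}^{(i-1)})$; (3) for $n-k\le i\le n-1$ and $1\le j\le n-1$: (i) $h_0^{(i)}=\delta(h_0^{(i-1)})-a_0\sigma(h_{n-1}^{(i-1)})$, and (ii) $h_j^{(i)}=\delta(h_j^{(i-1)})+\sigma(h_{j-1}^{(i-1)})-a_j\sigma(h_{n-1}^{(i-1)})$.
   Context: $A$ is a ring with identity (not necessarily finite or commutative); $\sigma:A\to A$ is a ring endomorphism with $\sigma(1)=1$; $\delta$ is a $\sigma$-derivation of $A$, i.e. $\delta$ is additive and $\delta(ab)=\sigma(a)\delta(b)+\delta(a)b$. $A[X;\sigma,\delta]$ is the skew-polynomial ring of elements $\sum a_iX^i$ with multiplication determined by $Xa=\sigma(a)X+\delta(a)$; $(p)_l$ is the left ideal generated by $p$. With $C_f$ the companion matrix of $f$ (ones on the superdiagonal, last row $(-a_0,\dots,-a_{n-1})$, zeros elsewhere), let $T_f:A^n\to A^n$, $T_f(x_0,\dots,x_{n-1})=(\sigma(x_0),\dots,\sigma(x_{n-1}))C_f+(\delta(x_0),\dots,\delta(x_{n-1}))$, and for $m\ge0$ write $(x_0^{(m)},\dots,x_{n-1}^{(m)})=T_f^m(x_0,\dots,x_{n-1})$, so $x_i^{(0)}=x_i$. This notation is applied to $(h_0,\dots,h_k,0,\dots,0)\in A^n$. Let $\phi_f:A^n\to A[X;\sigma,\delta]/(f)_l$,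 $(d_0,\dots,d_{n-1})\mapsto\sum_{i=0}^{n-1} d_iX^i+(f)_l$ (a bijection). The principal $(f,\sigma,\delta)$-code generated by a right divisor $g$ of $f$ is $\phi_f^{-1}((g)_l/(f)_l)\subseteq A^n$. For $H\in M_{n,t}(A)$ with $t\le n$, $\mathrm{Ann}_l(H)=\{x\in A^n: xH=0\}$; $H$ is a control matrix of such a code $\mathcal{C}\subseteq A^n$ if $\mathcal{C}=\mathrm{Ann}_l(H)$.
   Formalization: Adds: for 0≤m≤n-k-1, rσ^m(h_k)=0 implies r=0 (automatic if σ is injective or h is monic; the claim can fail otherwise). In (3) the products are σ(h_{n-1}^{(i-1)})a_0 and σ(h_{n-1}^{(i-1)})a_j, the order T_f gives; the printed order is false for noncommutative A. *)

theory Defs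
  imports
    "HOL-Computational_Algebra.Polynomial"
    "HOL-Library.Set_Algebras"
    "Jordan_Normal_Form.Matrix"
begin

section \<open>Skew polynomials\<close>

locale skew_data = ring_hom \<sigma> for \<sigma> :: "'a::ring_1 \<Rightarrow> 'a" +
  fixes \<delta> :: "'a \<Rightarrow> 'a"
  assumes delta_add: "\<delta> (a + b) = \<delta> a + \<delta> b"
    and delta_mult: "\<delta> (a * b) = \<sigma> a * \<delta> b + \<delta> a * b"

text \<open>
  The additive group of \<open>A[X;\<sigma>,\<delta>]\<close> is the type \<open>'a poly\<close>, with coefficients written to the left of
  the powers of \<open>X\<close>.  For noncommutative \<open>'a\<close> this type carries no library multiplication, and the
  skew product below is the only product used.  It is forced by \<open>X a = \<sigma>(a) X + \<delta>(a)\<close>: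
  left multiplication by \<open>X\<close> sends \<open>\<Sum> b\<^sub>j X\<^sup>j\<close> to \<open>\<Sum> (\<sigma>(b\<^sub>j) X\<^bsup>j+1\<^esup> + \<delta>(b\<^sub>j) X\<^sup>j)\<close>, and
  \<open>(\<Sum> a\<^sub>i X\<^sup>i) q = \<Sum> a\<^sub>i (X\<^sup>i q)\<close>.
\<close>

definition skew_X_mult :: "('a::ring_1 \<Rightarrow> 'a) \<Rightarrow> ('a \<Rightarrow> 'a) \<Rightarrow> 'a poly \<Rightarrow> 'a poly" where
  "skew_X_mult \<sigma> \<delta> q = pCons 0 (map_poly \<sigma> q) + map_poly \<delta> q"

definition skew_mult :: "('a::ring_1 \<Rightarrow> 'a) \<Rightarrow> ('a \<Rightarrow> 'a) \<Rightarrow> 'a poly \<Rightarrow> 'a poly \<Rightarrow> 'a poly" where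
  "skew_mult \<sigma> \<delta> p q =
     (\<Sum>i\<le>degree p. map_poly (\<lambda>b. coeff p i * b) ((skew_X_mult \<sigma> \<delta> ^^ i) q))"

context skew_data
begin

text \<open>Sanity check: \<open>skew_mult\<close> is a unital associative bi-additive product which satisfies the
  commutation rule.\<close>

lemma delta_0 [simp]: "\<delta> 0 = 0"
  using delta_add[of 0 0] by simp

lemma coeff_skew_X_mult:
  "coeff (skew_X_mult \<sigma> \<delta> q) i = (case i of 0 \<Rightarrow> 0 | Suc j \<Rightarrow> \<sigma> (coeff q j)) + \<delta> (coeff q i)"
  by (simp add: skew_X_mult_def coeff_map_poly coeff_pCons split: nat.split)

lemma skew_X_mult_add:
  "skew_X_mult \<sigma> \<delta> (p + q) = skew_X_mult \<sigma> \<delta> p + skew_X_mult \<sigma> \<delta> q"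
  by (rule poly_eqI) (simp add: coeff_skew_X_mult delta_add hom_add split: nat.split)

lemma skew_X_mult_0 [simp]: "skew_X_mult \<sigma> \<delta> 0 = 0"
  by (simp add: skew_X_mult_def)

lemma skew_X_pow_0 [simp]: "(skew_X_mult \<sigma> \<delta> ^^ i) 0 = 0"
  by (induction i) auto

lemma skew_X_pow_add:
  "(skew_X_mult \<sigma> \<delta> ^^ i) (p + q) = (skew_X_mult \<sigma> \<delta> ^^ i) p + (skew_X_mult \<sigma> \<delta> ^^ i) q"
  by (induction i) (auto simp: skew_X_mult_add)

lemma skew_X_mult_scale:
  "skew_X_mult \<sigma> \<delta> (map_poly (\<lambda>b. a * b) q) =
     map_poly (\<lambda>b. \<sigma> a * b) (skew_X_mult \<sigma> \<delta> q) + map_poly (\<lambda>b. \<delta> a * b) q"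
  by (rule poly_eqI)
     (simp add: coeff_skew_X_mult coeff_map_poly hom_mult delta_mult algebra_simps split: nat.split)

lemma skew_mult_bound:
  assumes "degree p \<le> N"
  shows "skew_mult \<sigma> \<delta> p q =
           (\<Sum>i\<le>N. map_poly (\<lambda>b. coeff p i * b) ((skew_X_mult \<sigma> \<delta> ^^ i) q))"
  unfolding skew_mult_def
  by (rule sum.mono_neutral_left) (use assms in \<open>auto simp: coeff_eq_0 poly_eq_iff coeff_map_poly\<close>)

lemma skew_mult_add_left:
  "skew_mult \<sigma> \<delta> (p + p') q = skew_mult \<sigma> \<delta> p q + skew_mult \<sigma> \<delta> p' q"
proof -
  define N where "N = max (degree p) (degree p')"
  have N: "degree p \<le> N" "degree p' \<le> N" "degree (p + p') \<le> N"
    using degree_add_le_max[of p p'] by (auto simp: N_def)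
  have "map_poly (\<lambda>b. (a + a') * b) s = map_poly (\<lambda>b. a * b) s + map_poly (\<lambda>b. a' * b) s"
    for a a' :: 'a and s
    by (rule poly_eqI) (simp add: coeff_map_poly distrib_right)
  then show ?thesis
    by (simp add: N[THEN skew_mult_bound] sum.distrib)
qed

lemma map_poly_scale_add:
  "map_poly (\<lambda>b. a * b) (s + t) = map_poly (\<lambda>b. a * b) s + map_poly (\<lambda>b. (a::'a) * b) t"
  by (rule poly_eqI) (simp add: coeff_map_poly distrib_left)

lemma skew_mult_add_right:
  "skew_mult \<sigma> \<delta> p (q + q') = skew_mult \<sigma> \<delta> p q + skew_mult \<sigma> \<delta> p q'"
  by (simp add: skew_mult_def skew_X_pow_add map_poly_scale_add sum.distrib)

lemma skew_mult_0_left [simp]: "skew_mult \<sigma> \<delta> 0 q = 0"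
  by (simp add: skew_mult_def poly_eq_iff coeff_map_poly)

lemma skew_mult_monom:
  "skew_mult \<sigma> \<delta> (monom a i) q = map_poly (\<lambda>b. a * b) ((skew_X_mult \<sigma> \<delta> ^^ i) q)"
proof -
  have "skew_mult \<sigma> \<delta> (monom a i) q =
      (\<Sum>j\<le>i. map_poly (\<lambda>b. coeff (monom a i) j * b) ((skew_X_mult \<sigma> \<delta> ^^ j) q))"
    by (rule skew_mult_bound) (rule degree_monom_le)
  also have "\<dots> = (\<Sum>j\<in>{i}. map_poly (\<lambda>b. a * b) ((skew_X_mult \<sigma> \<delta> ^^ j) q))"
    by (rule sum.mono_neutral_cong_right) (auto simp: poly_eq_iff coeff_map_poly)
  finally show ?thesis by simp
qed

lemma skew_mult_X: "skew_mult \<sigma> \<delta> (monom 1 1) q = skew_X_mult \<sigma> \<delta> q"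
  by (simp add: skew_mult_monom)

lemma skew_mult_1_left: "skew_mult \<sigma> \<delta> (monom 1 0) q = q"
  by (simp add: skew_mult_monom)

lemma skew_X_pow_one: "(skew_X_mult \<sigma> \<delta> ^^ i) (monom 1 0) = monom 1 i"
proof (induction i)
  case (Suc i)
  have "\<delta> 1 = 0" using delta_mult[of 1 1] by simp
  with Suc show ?case
    by (simp add: skew_X_mult_def map_poly_monom monom_Suc)
qed simp

lemma skew_mult_1_right: "skew_mult \<sigma> \<delta> p (monom 1 0) = p"
  by (simp add: skew_mult_def skew_X_pow_one map_poly_monom poly_as_sum_of_monoms)

lemma skew_commutation:
  "skew_mult \<sigma> \<delta> (monom 1 1) (monom a 0) = skew_mult \<sigma> \<delta> (monom (\<sigma> a) 0) (monom 1 1) + monom (\<delta> a) 0"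
  unfolding skew_mult_monom
  by (simp add: skew_X_mult_def map_poly_monom monom_Suc map_poly_pCons map_poly_idI)

lemma poly_monom_induct:
  fixes P :: "'a poly \<Rightarrow> bool"
  assumes "P 0" "\<And>p q. P p \<Longrightarrow> P q \<Longrightarrow> P (p + q)" "\<And>a i. P (monom a i)"
  shows "P p"
proof -
  have "P (\<Sum>i\<in>I. monom (coeff p i) i)" if "finite I" for I
    using that by (induction I) (auto intro: assms)
  from this[of "{..degree p}"] show ?thesis by (simp add: poly_as_sum_of_monoms)
qed

lemma skew_mult_scale_left:
  "skew_mult \<sigma> \<delta> (map_poly (\<lambda>b. a * b) q) r = map_poly (\<lambda>b. a * b) (skew_mult \<sigma> \<delta> q r)"
proof (induction q rule: poly_monom_induct)
  case (3 b i)
  show ?case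
    by (simp add: map_poly_monom skew_mult_monom poly_eq_iff coeff_map_poly mult.assoc)
qed (simp_all add: map_poly_scale_add skew_mult_add_left)

lemma skew_mult_skew_X_left:
  "skew_mult \<sigma> \<delta> (skew_X_mult \<sigma> \<delta> q) r = skew_X_mult \<sigma> \<delta> (skew_mult \<sigma> \<delta> q r)"
proof (induction q rule: poly_monom_induct)
  case (3 b i)
  have "skew_X_mult \<sigma> \<delta> (monom b i) = monom (\<sigma> b) (Suc i) + monom (\<delta> b) i"
    by (simp add: skew_X_mult_def map_poly_monom monom_Suc)
  then show ?case
    by (simp add: skew_mult_add_left skew_mult_monom skew_X_mult_scale)
qed (simp_all add: skew_X_mult_add skew_mult_add_left)

lemma skew_mult_assoc:
  "skew_mult \<sigma> \<delta> (skew_mult \<sigma> \<delta> p q) r = skew_mult \<sigma> \<delta> p (skew_mult \<sigma> \<delta> q r)"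
proof (induction p rule: poly_monom_induct)
  case (3 a i)
  have "skew_mult \<sigma> \<delta> ((skew_X_mult \<sigma> \<delta> ^^ i) q) r = (skew_X_mult \<sigma> \<delta> ^^ i) (skew_mult \<sigma> \<delta> q r)"
    by (induction i) (simp_all add: skew_mult_skew_X_left)
  then show ?case
    by (simp add: skew_mult_monom skew_mult_scale_left)
qed (simp_all add: skew_mult_add_left)

end

definition skew_right_divisor ::
    "('a::ring_1 \<Rightarrow> 'a) \<Rightarrow> ('a \<Rightarrow> 'a) \<Rightarrow> 'a poly \<Rightarrow> 'a poly \<Rightarrow> bool" where
  "skew_right_divisor \<sigma> \<delta> g f \<longleftrightarrow> (\<exists>q. f = skew_mult \<sigma> \<delta> q g)"

definition skew_left_ideal ::
    "('a::ring_1 \<Rightarrow> 'a) \<Rightarrow> ('a \<Rightarrow> 'a) \<Rightarrow> 'a poly \<Rightarrow> 'a poly set" where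
  "skew_left_ideal \<sigma> \<delta> p = {skew_mult \<sigma> \<delta> q p | q. True}"

section \<open>Principal codes and control matrices\<close>

text \<open>Elements of \<open>A[X;\<sigma>,\<delta>]/(f)\<^sub>l\<close> are the cosets \<open>p +o (f)\<^sub>l\<close>; the length of the code is
  \<open>n = degree f\<close>.\<close>

definition skew_phi ::
    "('a::ring_1 \<Rightarrow> 'a) \<Rightarrow> ('a \<Rightarrow> 'a) \<Rightarrow> 'a poly \<Rightarrow> 'a vec \<Rightarrow> 'a poly set" where
  "skew_phi \<sigma> \<delta> f d = (\<Sum>i<degree f. monom (d $ i) i) +o skew_left_ideal \<sigma> \<delta> f"

definition principal_code ::
    "('a::ring_1 \<Rightarrow> 'a) \<Rightarrow> ('a \<Rightarrow> 'a) \<Rightarrow> 'a poly \<Rightarrow> 'a poly \<Rightarrow> 'a vec set" where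
  "principal_code \<sigma> \<delta> f g =
     {d \<in> carrier_vec (degree f).
        skew_phi \<sigma> \<delta> f d \<in> (\<lambda>p. p +o skew_left_ideal \<sigma> \<delta> f) ` skew_left_ideal \<sigma> \<delta> g}"

definition vec_mult_mat :: "'a::semiring_0 vec \<Rightarrow> 'a mat \<Rightarrow> 'a vec" where
  "vec_mult_mat x M = vec (dim_col M) (\<lambda>j. x \<bullet> col M j)"

definition left_annihilator :: "'a::semiring_0 mat \<Rightarrow> 'a vec set" where
  "left_annihilator H = {x \<in> carrier_vec (dim_row H). vec_mult_mat x H = 0\<^sub>v (dim_col H)}"

definition is_control_matrix ::
    "nat \<Rightarrow> nat \<Rightarrow> 'a::semiring_0 mat \<Rightarrow> 'a vec set \<Rightarrow> bool" where
  "is_control_matrix n t H C \<longleftrightarrow> t \<le> n \<and> H \<in> carrier_mat n t \<and> C = left_annihilator H"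

definition companion :: "'a::ring_1 poly \<Rightarrow> 'a mat" where
  "companion f = mat (degree f) (degree f)
     (\<lambda>(i, j). if i = degree f - 1 then - coeff f j else if j = Suc i then 1 else 0)"

definition skew_T :: "('a::ring_1 \<Rightarrow> 'a) \<Rightarrow> ('a \<Rightarrow> 'a) \<Rightarrow> 'a poly \<Rightarrow> 'a vec \<Rightarrow> 'a vec" where
  "skew_T \<sigma> \<delta> f x = vec_mult_mat (map_vec \<sigma> x) (companion f) + map_vec \<delta> x"

text \<open>\<open>T_iter \<sigma> \<delta> f h k m j\<close> is \<open>h\<^sub>j\<^bsup>(m)\<^esup>\<close>: the \<open>j\<close>-th entry of
  \<open>T\<^sub>f\<^sup>m (h\<^sub>0, \<dots>, h\<^sub>k, 0, \<dots>, 0)\<close>, meaningful for \<open>k < degree f\<close> and \<open>j < degree f\<close>.\<close>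

definition T_iter ::
    "('a::ring_1 \<Rightarrow> 'a) \<Rightarrow> ('a \<Rightarrow> 'a) \<Rightarrow> 'a poly \<Rightarrow> 'a poly \<Rightarrow> nat \<Rightarrow> nat \<Rightarrow> nat \<Rightarrow> 'a" where
  "T_iter \<sigma> \<delta> f h k m j =
     (skew_T \<sigma> \<delta> f ^^ m) (vec (degree f) (\<lambda>i. if i \<le> k then coeff h i else 0)) $ j"

text \<open>Rows and columns are numbered from \<open>0\<close>.  Row \<open>i \<le> n - k - 1\<close> is
  \<open>h\<^sub>0\<^bsup>(i)\<^esup>, \<dots>, h\<^bsub>k+i-1\<^esub>\<^bsup>(i)\<^esup>, \<sigma>\<^sup>i(h\<^sub>k), 0, \<dots>, 0\<close>.\<close>

definition staircase_matrix ::
    "('a::ring_1 \<Rightarrow> 'a) \<Rightarrow> ('a \<Rightarrow> 'a) \<Rightarrow> 'a poly \<Rightarrow> 'a poly \<Rightarrow> nat \<Rightarrow> 'a mat" where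
  "staircase_matrix \<sigma> \<delta> f h k = mat (degree f) (degree f)
     (\<lambda>(i, j). if i < degree f - k \<and> j = k + i then (\<sigma> ^^ i) (coeff h k)
               else if i < degree f - k \<and> k + i < j then 0
               else T_iter \<sigma> \<delta> f h k i j)"

end

theory Submission
  imports Defs
begin

text \<open>
  Write \<open>R = A[X;\<sigma>,\<delta>]\<close>, and for \<open>x \<in> A\<^sup>n\<close> let \<open>P(x) = \<Sum> x\<^sub>j X\<^sup>j\<close>.  The map \<open>T\<^sub>f\<close> is left
  multiplication by \<open>X\<close> modulo \<open>(f)\<^sub>l\<close>: since \<open>f\<close> is monic, subtracting \<open>\<sigma>(x\<^bsub>n-1\<^esub>) f\<close> from \<open>X P(x)\<close>
  removes the term of degree \<open>n\<close>, and what is left is \<open>P(T\<^sub>f x)\<close> (lemma \<open>vec_poly_skew_T\<close>).  Hence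
  the \<open>i\<close>-th row of the matrix is the remainder of \<open>X\<^sup>i h\<close> modulo \<open>f\<close>, and \<open>P(d) h\<close> is congruent to
  \<open>P(dH)\<close> modulo \<open>(f)\<^sub>l\<close> (lemma \<open>skew_mult_cong_vec_mult_mat\<close>).  A multiple of \<open>f\<close> of degree less
  than \<open>n\<close> is zero, so \<open>dH = 0\<close> if and only if \<open>P(d) h \<in> (f)\<^sub>l\<close>.

  The vector \<open>d\<close> is in the code if and only if \<open>P(d) \<in> (g)\<^sub>l\<close>, because \<open>g\<close> is a right divisor of \<open>f\<close>.
  It remains to compare \<open>p \<in> (g)\<^sub>l\<close> with \<open>p h \<in> (f)\<^sub>l\<close>
  (lemma \<open>right_factor_detects_left_ideal\<close>).  One direction is \<open>(r g) h = r f\<close>.  For the other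
  direction divide: \<open>p = s g + t\<close> with \<open>deg t < n - k\<close>.  Then \<open>t h = p h - s f\<close> is in \<open>(f)\<^sub>l\<close> and
  has degree less than \<open>n\<close>, so \<open>t h = 0\<close>.  If \<open>t \<noteq> 0\<close> had degree \<open>m\<close>, its leading coefficient would
  annihilate \<open>\<sigma>\<^sup>m(h\<^sub>k)\<close> from the left, which the regularity hypothesis excludes.

  The staircase shape and the short recursion hold because \<open>X\<^sup>i h\<close> has degree at most \<open>k + i\<close>,
  with coefficient \<open>\<sigma>\<^sup>i(h\<^sub>k)\<close> in that degree: as long as \<open>k + i < n\<close> no reduction by \<open>f\<close> takes place, so the \<open>i\<close>-th row lists the
  coefficients of \<open>X\<^sup>i h\<close> itself.
\<close>

section \<open>Degrees and division by monic skew polynomials\<close>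

context skew_data
begin

lemma skew_mult_diff_left:
  "skew_mult \<sigma> \<delta> (p - p') q = skew_mult \<sigma> \<delta> p q - skew_mult \<sigma> \<delta> p' q"
  using skew_mult_add_left[of "p - p'" p' q] by simp

lemma skew_X_pow_top:
  assumes "degree q \<le> d"
  shows "degree ((skew_X_mult \<sigma> \<delta> ^^ i) q) \<le> d + i"
    and "coeff ((skew_X_mult \<sigma> \<delta> ^^ i) q) (d + i) = (\<sigma> ^^ i) (coeff q d)"
proof (induction i)
  case 0
  show "degree ((skew_X_mult \<sigma> \<delta> ^^ 0) q) \<le> d + 0" using assms by simp
next
  case (Suc i)
  show "degree ((skew_X_mult \<sigma> \<delta> ^^ Suc i) q) \<le> d + Suc i"
  proof (rule degree_le, intro allI impI)
    fix j assume "d + Suc i < j"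
    with Suc show "coeff ((skew_X_mult \<sigma> \<delta> ^^ Suc i) q) j = 0"
      by (cases j) (auto simp: coeff_skew_X_mult coeff_eq_0 hom_zero)
  qed
  show "coeff ((skew_X_mult \<sigma> \<delta> ^^ Suc i) q) (d + Suc i) = (\<sigma> ^^ Suc i) (coeff q d)"
    using Suc by (simp add: coeff_skew_X_mult coeff_eq_0)
qed simp

lemma skew_mult_top:
  assumes "degree p \<le> m" "degree q \<le> d"
  shows "degree (skew_mult \<sigma> \<delta> p q) \<le> m + d"
    and "coeff (skew_mult \<sigma> \<delta> p q) (m + d) = coeff p m * (\<sigma> ^^ m) (coeff q d)"
proof -
  have coeff: "coeff (skew_mult \<sigma> \<delta> p q) j =
      (\<Sum>i\<le>m. coeff p i * coeff ((skew_X_mult \<sigma> \<delta> ^^ i) q) j)" for j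
    by (simp add: skew_mult_bound[OF assms(1)] coeff_sum coeff_map_poly)
  have vanish: "coeff ((skew_X_mult \<sigma> \<delta> ^^ i) q) j = 0" if "d + i < j" for i j
    using skew_X_pow_top(1)[OF assms(2), of i] that by (simp add: coeff_eq_0)
  show "degree (skew_mult \<sigma> \<delta> p q) \<le> m + d"
    by (rule degree_le) (auto simp: coeff vanish)
  have "coeff (skew_mult \<sigma> \<delta> p q) (m + d) =
      (\<Sum>i\<in>{m}. coeff p i * coeff ((skew_X_mult \<sigma> \<delta> ^^ i) q) (m + d))"
    unfolding coeff by (rule sum.mono_neutral_right) (auto simp: vanish)
  then show "coeff (skew_mult \<sigma> \<delta> p q) (m + d) = coeff p m * (\<sigma> ^^ m) (coeff q d)"
    using skew_X_pow_top(2)[OF assms(2), of m] by (simp add: add.commute)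
qed

lemma sigma_pow_1: "(\<sigma> ^^ i) 1 = 1"
  by (induction i) (auto simp: hom_one)

text \<open>A leading term \<open>c X\<^bsup>e\<^esup>\<close> is cancelled by \<open>(c X\<^bsup>e - deg g\<^esup>) g\<close>, whose coefficient in degree
  \<open>e\<close> is \<open>c \<sigma>\<^bsup>e - deg g\<^esup>(1) = c\<close>.\<close>

lemma skew_right_division:
  assumes monic: "lead_coeff g = 1" and pos: "0 < degree g"
  shows "\<exists>s t. p = skew_mult \<sigma> \<delta> s g + t \<and> degree t < degree g"
proof (induction "degree p" arbitrary: p rule: less_induct)
  case less
  show ?case
  proof (cases "degree p < degree g")
    case True
    then show ?thesis by (intro exI[of _ 0] exI[of _ p]) simp
  next
    case False
    define m where "m = degree p - degree g"
    have m: "m + degree g = degree p" using False by (simp add: m_def)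
    define q where "q = monom (lead_coeff p) m"
    define p' where "p' = p - skew_mult \<sigma> \<delta> q g"
    have top: "degree (skew_mult \<sigma> \<delta> q g) \<le> degree p"
         "coeff (skew_mult \<sigma> \<delta> q g) (degree p) = lead_coeff p"
      using skew_mult_top[of q m g "degree g"]
      by (simp_all add: m q_def degree_monom_le monic sigma_pow_1)
    have deg: "degree p' \<le> degree p"
      unfolding p'_def using top(1) by (intro degree_diff_le) auto
    have "coeff p' (degree p) = 0" by (simp add: p'_def top(2))
    with deg have "degree p' < degree p"
      using False pos
      by (metis coeff_0_degree_minus_1 degree_0 diff_less le_neq_implies_less leading_coeff_0_iff
          linorder_not_less order.strict_trans2 zero_less_one)
    then obtain s t where "p' = skew_mult \<sigma> \<delta> s g + t" "degree t < degree g"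
      using less.hyps by blast
    then show ?thesis
      by (intro exI[of _ "s + q"] exI[of _ t])
         (simp add: p'_def skew_mult_add_left algebra_simps)
  qed
qed

section \<open>Left ideals\<close>

lemma zero_in_left_ideal: "0 \<in> skew_left_ideal \<sigma> \<delta> f"
  unfolding skew_left_ideal_def using skew_mult_0_left[of f] by (metis (mono_tags, lifting) mem_Collect_eq)

lemma self_in_left_ideal: "f \<in> skew_left_ideal \<sigma> \<delta> f"
  unfolding skew_left_ideal_def using skew_mult_1_left[of f] by (metis (mono_tags, lifting) mem_Collect_eq)

lemma left_ideal_add:
  "p \<in> skew_left_ideal \<sigma> \<delta> f \<Longrightarrow> q \<in> skew_left_ideal \<sigma> \<delta> f \<Longrightarrow> p + q \<in> skew_left_ideal \<sigma> \<delta> f"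
  unfolding skew_left_ideal_def using skew_mult_add_left by (auto, metis)

lemma left_ideal_diff:
  "p \<in> skew_left_ideal \<sigma> \<delta> f \<Longrightarrow> q \<in> skew_left_ideal \<sigma> \<delta> f \<Longrightarrow> p - q \<in> skew_left_ideal \<sigma> \<delta> f"
  unfolding skew_left_ideal_def using skew_mult_diff_left by (auto, metis)

lemma left_ideal_mult:
  "p \<in> skew_left_ideal \<sigma> \<delta> f \<Longrightarrow> skew_mult \<sigma> \<delta> r p \<in> skew_left_ideal \<sigma> \<delta> f"
  unfolding skew_left_ideal_def using skew_mult_assoc by (auto, metis)

lemma left_ideal_sum:
  "(\<And>i. i \<in> I \<Longrightarrow> p i \<in> skew_left_ideal \<sigma> \<delta> f) \<Longrightarrow> sum p I \<in> skew_left_ideal \<sigma> \<delta> f"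
  by (induction I rule: infinite_finite_induct) (auto simp: zero_in_left_ideal left_ideal_add)

lemma left_ideal_mem_cong:
  assumes "p - q \<in> skew_left_ideal \<sigma> \<delta> f"
  shows "p \<in> skew_left_ideal \<sigma> \<delta> f \<longleftrightarrow> q \<in> skew_left_ideal \<sigma> \<delta> f"
  using left_ideal_add[OF assms, of q] left_ideal_diff[OF _ assms, of p] by auto

text \<open>If \<open>q \<noteq> 0\<close>, then \<open>q f\<close> has the same leading coefficient as \<open>q\<close>, in degree
  \<open>deg q + deg f\<close>, because \<open>\<sigma>\<close> fixes the leading coefficient \<open>1\<close> of \<open>f\<close>.\<close>

lemma left_ideal_small_degree:
  assumes monic: "lead_coeff f = 1" and p: "p \<in> skew_left_ideal \<sigma> \<delta> f"
    and small: "\<And>j. degree f \<le> j \<Longrightarrow> coeff p j = 0"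
  shows "p = 0"
proof -
  obtain q where q: "p = skew_mult \<sigma> \<delta> q f" using p by (auto simp: skew_left_ideal_def)
  have "coeff p (degree q + degree f) = lead_coeff q"
    using skew_mult_top(2)[of q "degree q" f "degree f"] by (simp add: q monic sigma_pow_1)
  with small have "q = 0" by (simp add: leading_coeff_0_iff)
  then show ?thesis by (simp add: q)
qed

text \<open>If \<open>f = g h\<close>, then \<open>h\<close> on the right tests membership in \<open>(g)\<^sub>l\<close>.  Left regularity of the
  \<open>\<sigma>\<^sup>m(h\<^sub>k)\<close> is what makes right multiplication by \<open>h\<close> injective on the remainders modulo \<open>g\<close>.\<close>

lemma right_factor_detects_left_ideal:
  assumes f: "f = skew_mult \<sigma> \<delta> g h" "lead_coeff f = 1" "degree f = degree g + k"
    and g: "lead_coeff g = 1" "0 < degree g"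
    and h: "degree h \<le> k"
    and regular: "\<And>m r. m < degree g \<Longrightarrow> r * (\<sigma> ^^ m) (coeff h k) = 0 \<Longrightarrow> r = 0"
  shows "skew_mult \<sigma> \<delta> p h \<in> skew_left_ideal \<sigma> \<delta> f \<longleftrightarrow> p \<in> skew_left_ideal \<sigma> \<delta> g"
proof
  assume "p \<in> skew_left_ideal \<sigma> \<delta> g"
  then obtain r where "p = skew_mult \<sigma> \<delta> r g" by (auto simp: skew_left_ideal_def)
  then have "skew_mult \<sigma> \<delta> p h = skew_mult \<sigma> \<delta> r f" by (simp add: f(1) skew_mult_assoc)
  then show "skew_mult \<sigma> \<delta> p h \<in> skew_left_ideal \<sigma> \<delta> f" by (auto simp: skew_left_ideal_def)
next
  assume ph: "skew_mult \<sigma> \<delta> p h \<in> skew_left_ideal \<sigma> \<delta> f"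
  obtain s t where p: "p = skew_mult \<sigma> \<delta> s g + t" and t: "degree t < degree g"
    using skew_right_division[OF g] by blast
  have "skew_mult \<sigma> \<delta> t h = skew_mult \<sigma> \<delta> p h - skew_mult \<sigma> \<delta> s f"
    by (simp add: p f(1) skew_mult_add_left skew_mult_assoc)
  moreover have "skew_mult \<sigma> \<delta> s f \<in> skew_left_ideal \<sigma> \<delta> f"
    by (rule left_ideal_mult[OF self_in_left_ideal])
  ultimately have th: "skew_mult \<sigma> \<delta> t h \<in> skew_left_ideal \<sigma> \<delta> f"
    using ph left_ideal_diff by simp
  note top = skew_mult_top[OF order_refl h, of t]
  have "skew_mult \<sigma> \<delta> t h = 0"
    using top(1) t f(3) by (intro left_ideal_small_degree[OF f(2) th] coeff_eq_0) simp
  with top(2) have "lead_coeff t * (\<sigma> ^^ degree t) (coeff h k) = 0" by simp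
  then have "lead_coeff t = 0" by (rule regular[OF t])
  then have "t = 0" by (simp add: leading_coeff_0_iff)
  then show "p \<in> skew_left_ideal \<sigma> \<delta> g" by (auto simp: p skew_left_ideal_def)
qed

end

section \<open>Vectors as skew polynomials\<close>

definition vec_poly :: "nat \<Rightarrow> 'a::comm_monoid_add vec \<Rightarrow> 'a poly" where
  "vec_poly n x = (\<Sum>i<n. monom (x $ i) i)"

lemma coeff_vec_poly: "coeff (vec_poly n x) j = (if j < n then x $ j else 0)"
  by (simp add: vec_poly_def coeff_sum sum.delta)

lemma vec_poly_eq_0_iff:
  assumes "x \<in> carrier_vec n"
  shows "vec_poly n x = 0 \<longleftrightarrow> x = 0\<^sub>v n"
  using assms by (auto simp: poly_eq_iff coeff_vec_poly vec_eq_iff)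

lemma vec_poly_vec_mult_mat:
  assumes "dim_vec x = dim_row M" "dim_col M = n"
  shows "vec_poly n (vec_mult_mat x M) =
    (\<Sum>i<dim_row M. map_poly (\<lambda>b. x $ i * b) (vec_poly n (row M i)))"
proof (rule poly_eqI)
  fix j
  show "coeff (vec_poly n (vec_mult_mat x M)) j =
      coeff (\<Sum>i<dim_row M. map_poly (\<lambda>b. x $ i * b) (vec_poly n (row M i))) j"
    using assms
    by (simp add: coeff_vec_poly coeff_sum coeff_map_poly vec_mult_mat_def scalar_prod_def
        atLeast0LessThan)
qed

section \<open>The companion map is multiplication by X\<close>

context skew_data
begin

lemma skew_T_carrier: "x \<in> carrier_vec (degree f) \<Longrightarrow> skew_T \<sigma> \<delta> f x \<in> carrier_vec (degree f)"
  by (simp add: skew_T_def vec_mult_mat_def companion_def)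

lemma skew_T_pow_carrier:
  "x \<in> carrier_vec (degree f) \<Longrightarrow> (skew_T \<sigma> \<delta> f ^^ m) x \<in> carrier_vec (degree f)"
  by (induction m) (auto simp: skew_T_carrier)

lemma skew_T_index:
  assumes x: "x \<in> carrier_vec (degree f)" and j: "j < degree f"
  shows "skew_T \<sigma> \<delta> f x $ j =
    (case j of 0 \<Rightarrow> 0 | Suc i \<Rightarrow> \<sigma> (x $ i)) + \<delta> (x $ j) - \<sigma> (x $ (degree f - 1)) * coeff f j"
proof -
  define n where "n = degree f"
  have n: "n = Suc (n - 1)" using j by (simp add: n_def)
  have "skew_T \<sigma> \<delta> f x $ j =
      (\<Sum>i<n. \<sigma> (x $ i) * (if i = n - 1 then - coeff f j else if j = Suc i then 1 else 0)) + \<delta> (x $ j)"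
    using x j by (simp add: skew_T_def vec_mult_mat_def companion_def scalar_prod_def n_def
        atLeast0LessThan)
  also have "(\<Sum>i<n. \<sigma> (x $ i) * (if i = n - 1 then - coeff f j else if j = Suc i then 1 else 0)) =
      (\<Sum>i<n - 1. if j = Suc i then \<sigma> (x $ i) else 0) - \<sigma> (x $ (n - 1)) * coeff f j"
    by (subst n, subst sum.lessThan_Suc) (auto intro!: sum.cong)
  also have "(\<Sum>i<n - 1. if j = Suc i then \<sigma> (x $ i) else 0) =
      (case j of 0 \<Rightarrow> 0 | Suc i \<Rightarrow> \<sigma> (x $ i))"
    using j by (cases j) (auto simp: n_def sum.delta)
  finally show ?thesis by (simp add: n_def algebra_simps)
qed

lemma vec_poly_skew_T:
  assumes monic: "lead_coeff f = 1" and pos: "0 < degree f" and x: "x \<in> carrier_vec (degree f)"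
  shows "vec_poly (degree f) (skew_T \<sigma> \<delta> f x) =
    skew_X_mult \<sigma> \<delta> (vec_poly (degree f) x) - skew_mult \<sigma> \<delta> (monom (\<sigma> (x $ (degree f - 1))) 0) f"
proof (rule poly_eqI)
  fix j
  consider "j < degree f" | "j = degree f" | "degree f < j" by linarith
  then show "coeff (vec_poly (degree f) (skew_T \<sigma> \<delta> f x)) j =
    coeff (skew_X_mult \<sigma> \<delta> (vec_poly (degree f) x)
      - skew_mult \<sigma> \<delta> (monom (\<sigma> (x $ (degree f - 1))) 0) f) j"
  proof cases
    case 1
    then show ?thesis
      using x by (simp add: coeff_vec_poly skew_T_index skew_mult_monom coeff_skew_X_mult
          coeff_map_poly split: nat.split)
  next
    case 2
    from pos obtain i where "degree f = Suc i" using gr0_conv_Suc by blast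
    with 2 monic show ?thesis
      by (simp add: coeff_vec_poly skew_mult_monom coeff_skew_X_mult coeff_map_poly)
  next
    case 3
    then show ?thesis
      by (cases j) (auto simp: coeff_vec_poly skew_mult_monom coeff_skew_X_mult
          coeff_map_poly coeff_eq_0 hom_zero)
  qed
qed

lemma skew_X_pow_cong_skew_T_pow:
  assumes monic: "lead_coeff f = 1" and pos: "0 < degree f" and x: "x \<in> carrier_vec (degree f)"
  shows "(skew_X_mult \<sigma> \<delta> ^^ m) (vec_poly (degree f) x)
    - vec_poly (degree f) ((skew_T \<sigma> \<delta> f ^^ m) x) \<in> skew_left_ideal \<sigma> \<delta> f"
proof (induction m)
  case 0
  show ?case by (simp add: zero_in_left_ideal)
next
  case (Suc m)
  define u where "u = (skew_X_mult \<sigma> \<delta> ^^ m) (vec_poly (degree f) x)"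
  define y where "y = (skew_T \<sigma> \<delta> f ^^ m) x"
  define c where "c = monom (\<sigma> (y $ (degree f - 1))) 0"
  have "skew_X_mult \<sigma> \<delta> u - vec_poly (degree f) (skew_T \<sigma> \<delta> f y) =
      skew_X_mult \<sigma> \<delta> u - skew_X_mult \<sigma> \<delta> (vec_poly (degree f) y) + skew_mult \<sigma> \<delta> c f"
    using skew_T_pow_carrier[OF x] by (simp add: vec_poly_skew_T[OF monic pos] y_def c_def)
  also have "skew_X_mult \<sigma> \<delta> u - skew_X_mult \<sigma> \<delta> (vec_poly (degree f) y) =
      skew_mult \<sigma> \<delta> (monom 1 1) (u - vec_poly (degree f) y)"
    using skew_X_mult_add[of "u - vec_poly (degree f) y" "vec_poly (degree f) y"]
    by (simp only: skew_mult_X) simp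
  also have "\<dots> + skew_mult \<sigma> \<delta> c f \<in> skew_left_ideal \<sigma> \<delta> f"
    using Suc unfolding u_def y_def
    by (intro left_ideal_add left_ideal_mult[OF self_in_left_ideal] left_ideal_mult)
  finally show ?case by (simp add: u_def y_def)
qed

text \<open>The rows of \<open>H\<close> are the residues of \<open>X\<^sup>i p\<close>, so a combination of the rows with coefficients
  \<open>d\<^sub>i\<close> is the residue of \<open>(\<Sum> d\<^sub>i X\<^sup>i) p\<close>.\<close>

lemma skew_mult_cong_vec_mult_mat:
  assumes monic: "lead_coeff f = 1" and pos: "0 < degree f" and x: "x \<in> carrier_vec (degree f)"
    and d: "d \<in> carrier_vec (degree f)" and H: "H \<in> carrier_mat (degree f) (degree f)"
    and rows: "\<And>i. i < degree f \<Longrightarrow> row H i = (skew_T \<sigma> \<delta> f ^^ i) x"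
  shows "skew_mult \<sigma> \<delta> (vec_poly (degree f) d) (vec_poly (degree f) x)
    - vec_poly (degree f) (vec_mult_mat d H) \<in> skew_left_ideal \<sigma> \<delta> f"
proof -
  define q where "q = vec_poly (degree f) x"
  define r where "r i = vec_poly (degree f) ((skew_T \<sigma> \<delta> f ^^ i) x)" for i
  have "skew_mult \<sigma> \<delta> (\<Sum>i\<in>I. monom (d $ i) i) q =
      (\<Sum>i\<in>I. map_poly (\<lambda>b. d $ i * b) ((skew_X_mult \<sigma> \<delta> ^^ i) q))" if "finite I" for I
    using that by (induction I) (auto simp: skew_mult_add_left skew_mult_monom)
  then have "skew_mult \<sigma> \<delta> (vec_poly (degree f) d) q =
      (\<Sum>i<degree f. map_poly (\<lambda>b. d $ i * b) ((skew_X_mult \<sigma> \<delta> ^^ i) q))"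
    by (simp add: vec_poly_def)
  moreover have "vec_poly (degree f) (vec_mult_mat d H) =
      (\<Sum>i<degree f. map_poly (\<lambda>b. d $ i * b) (r i))"
    using d H rows by (subst vec_poly_vec_mult_mat) (auto simp: r_def)
  ultimately have "skew_mult \<sigma> \<delta> (vec_poly (degree f) d) q - vec_poly (degree f) (vec_mult_mat d H) =
      (\<Sum>i<degree f. map_poly (\<lambda>b. d $ i * b) ((skew_X_mult \<sigma> \<delta> ^^ i) q)
        - map_poly (\<lambda>b. d $ i * b) (r i))"
    by (simp add: sum_subtractf)
  also have "\<dots> = (\<Sum>i<degree f. skew_mult \<sigma> \<delta> (monom (d $ i) 0) ((skew_X_mult \<sigma> \<delta> ^^ i) q - r i))"
    by (intro sum.cong refl poly_eqI) (simp add: skew_mult_monom coeff_map_poly right_diff_distrib)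
  also have "\<dots> \<in> skew_left_ideal \<sigma> \<delta> f"
    unfolding q_def r_def
    by (intro left_ideal_sum left_ideal_mult skew_X_pow_cong_skew_T_pow monic pos x)
  finally show ?thesis by (simp add: q_def)
qed

section \<open>The code and the staircase matrix\<close>

lemma principal_code_iff:
  assumes "skew_right_divisor \<sigma> \<delta> g f"
  shows "d \<in> principal_code \<sigma> \<delta> f g \<longleftrightarrow>
    d \<in> carrier_vec (degree f) \<and> vec_poly (degree f) d \<in> skew_left_ideal \<sigma> \<delta> g"
proof -
  have sub: "p \<in> skew_left_ideal \<sigma> \<delta> g" if "p \<in> skew_left_ideal \<sigma> \<delta> f" for p
  proof -
    obtain q where "f = skew_mult \<sigma> \<delta> q g" using assms by (auto simp: skew_right_divisor_def)
    then have "f \<in> skew_left_ideal \<sigma> \<delta> g" by (auto simp: skew_left_ideal_def)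
    with that show ?thesis
      by (auto simp: skew_left_ideal_def[of _ _ f] intro: left_ideal_mult)
  qed
  have "vec_poly (degree f) d \<in> skew_left_ideal \<sigma> \<delta> g"
    if p: "p \<in> skew_left_ideal \<sigma> \<delta> g" and eq: "skew_phi \<sigma> \<delta> f d = p +o skew_left_ideal \<sigma> \<delta> f" for p
  proof -
    have "vec_poly (degree f) d \<in> skew_phi \<sigma> \<delta> f d"
      using zero_in_left_ideal[of f] by (force simp: skew_phi_def vec_poly_def elt_set_plus_def)
    with eq obtain r where "vec_poly (degree f) d = p + r" "r \<in> skew_left_ideal \<sigma> \<delta> f"
      by (auto simp: elt_set_plus_def)
    with p sub show ?thesis by (auto intro: left_ideal_add)
  qed
  then show ?thesis
    unfolding principal_code_def by (auto simp: skew_phi_def vec_poly_def)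
qed

lemma T_iter_Suc:
  assumes "j < degree f"
  shows "T_iter \<sigma> \<delta> f h k (Suc i) j =
    (case j of 0 \<Rightarrow> 0 | Suc j' \<Rightarrow> \<sigma> (T_iter \<sigma> \<delta> f h k i j')) + \<delta> (T_iter \<sigma> \<delta> f h k i j)
      - \<sigma> (T_iter \<sigma> \<delta> f h k i (degree f - 1)) * coeff f j"
  using assms by (simp add: T_iter_def skew_T_index skew_T_pow_carrier split: nat.split)

text \<open>While \<open>k + i < n\<close>, the product \<open>X\<^sup>i h\<close> is its own remainder modulo \<open>f\<close>.\<close>

lemma T_iter_unreduced:
  assumes h: "degree h \<le> k" and "k + i < degree f" "j < degree f"
  shows "T_iter \<sigma> \<delta> f h k i j = coeff ((skew_X_mult \<sigma> \<delta> ^^ i) h) j"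
  using assms(2,3)
proof (induction i arbitrary: j)
  case 0
  then show ?case using h by (simp add: T_iter_def coeff_eq_0)
next
  case (Suc i)
  (* The entry that would multiply f lies in degree n - 1 > k + i, above the degree of X^i h. *)
  have "T_iter \<sigma> \<delta> f h k i (degree f - 1) = 0"
    using Suc skew_X_pow_top(1)[OF h, of i] by (simp add: coeff_eq_0)
  with Suc show ?case by (simp add: T_iter_Suc coeff_skew_X_mult hom_zero split: nat.split)
qed

lemma row_staircase_matrix:
  assumes h: "degree h \<le> k" and i: "i < degree f"
  shows "row (staircase_matrix \<sigma> \<delta> f h k) i =
    (skew_T \<sigma> \<delta> f ^^ i) (vec (degree f) (\<lambda>i. if i \<le> k then coeff h i else 0))"
    (is "_ = ?y")
proof (rule eq_vecI)
  have y: "?y \<in> carrier_vec (degree f)" by (rule skew_T_pow_carrier) simp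
  then show "dim_vec (row (staircase_matrix \<sigma> \<delta> f h k) i) = dim_vec ?y"
    by (simp add: staircase_matrix_def)
  fix j assume "j < dim_vec ?y"
  with y have j: "j < degree f" by simp
  show "row (staircase_matrix \<sigma> \<delta> f h k) i $ j = ?y $ j"
    using T_iter_unreduced[OF h _ j, of i] skew_X_pow_top[OF h, of i] i j
    by (auto simp: staircase_matrix_def T_iter_def coeff_eq_0)
qed

lemma staircase_matrix_is_control_matrix:
  assumes f: "f = skew_mult \<sigma> \<delta> g h" "lead_coeff f = 1" "degree f = degree g + k"
    and g: "lead_coeff g = 1" "0 < degree g" "skew_right_divisor \<sigma> \<delta> g f"
    and h: "degree h \<le> k"
    and regular: "\<And>m r. m < degree g \<Longrightarrow> r * (\<sigma> ^^ m) (coeff h k) = 0 \<Longrightarrow> r = 0"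
  shows "is_control_matrix (degree f) (degree f) (staircase_matrix \<sigma> \<delta> f h k)
    (principal_code \<sigma> \<delta> f g)"
proof -
  define n where "n = degree f"
  define H where "H = staircase_matrix \<sigma> \<delta> f h k"
  define x where "x = vec n (\<lambda>i. if i \<le> k then coeff h i else 0)"
  have x: "x \<in> carrier_vec n" by (simp add: x_def)
  have H: "H \<in> carrier_mat n n" by (simp add: H_def n_def staircase_matrix_def)
  have h_x: "vec_poly n x = h"
    using h f(3) g(2) by (intro poly_eqI) (auto simp: coeff_vec_poly x_def n_def coeff_eq_0)
  have "vec_mult_mat d H = 0\<^sub>v n \<longleftrightarrow> vec_poly n d \<in> skew_left_ideal \<sigma> \<delta> g"
    if d: "d \<in> carrier_vec n" for d
  proof -
    have dH: "vec_mult_mat d H \<in> carrier_vec n" using H by (simp add: vec_mult_mat_def)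
    have "vec_mult_mat d H = 0\<^sub>v n \<longleftrightarrow> vec_poly n (vec_mult_mat d H) = 0"
      by (simp add: vec_poly_eq_0_iff[OF dH])
    also have "\<dots> \<longleftrightarrow> vec_poly n (vec_mult_mat d H) \<in> skew_left_ideal \<sigma> \<delta> f"
      using left_ideal_small_degree[OF f(2), of "vec_poly n (vec_mult_mat d H)"]
        zero_in_left_ideal[of f]
      by (auto simp: coeff_vec_poly n_def)
    also have "\<dots> \<longleftrightarrow> skew_mult \<sigma> \<delta> (vec_poly n d) h \<in> skew_left_ideal \<sigma> \<delta> f"
      using skew_mult_cong_vec_mult_mat[OF f(2) _ x[unfolded n_def] d[unfolded n_def] H[unfolded n_def]]
        f(3) g(2) row_staircase_matrix[OF h, of _ f] h_x
      by (intro left_ideal_mem_cong[symmetric]) (auto simp: n_def H_def x_def)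
    also have "\<dots> \<longleftrightarrow> vec_poly n d \<in> skew_left_ideal \<sigma> \<delta> g"
      by (rule right_factor_detects_left_ideal[OF f g(1,2) h regular])
    finally show ?thesis .
  qed
  then have "principal_code \<sigma> \<delta> f g = left_annihilator H"
    using H by (auto simp: left_annihilator_def principal_code_iff[OF g(3)] n_def)
  then show ?thesis using H by (simp add: is_control_matrix_def H_def n_def)
qed

end

theorem theorem5p2:
  fixes \<sigma> \<delta> :: "'a::ring_1 \<Rightarrow> 'a" and f g h :: "'a poly" and n k :: nat and C :: "'a vec set"
  assumes "skew_data \<sigma> \<delta>"
    and "degree f = n" and "coeff f n = 1"
    and "k < n" and "degree g = n - k" and "coeff g (n - k) = 1"
    and "skew_right_divisor \<sigma> \<delta> g f"
    and "C = principal_code \<sigma> \<delta> f g"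
    and "degree h \<le> k" and "f = skew_mult \<sigma> \<delta> g h"
    and regular: "\<forall>m<n - k. \<forall>r. r * (\<sigma> ^^ m) (coeff h k) = 0 \<longrightarrow> r = 0"
  shows "is_control_matrix n n (staircase_matrix \<sigma> \<delta> f h k) C
    \<and> (\<forall>i. k + 1 \<le> i \<and> i \<le> n - 1 \<longrightarrow> T_iter \<sigma> \<delta> f h k 0 i = 0)
    \<and> (\<forall>i. 1 \<le> i \<and> i \<le> n - k - 1 \<longrightarrow>
          T_iter \<sigma> \<delta> f h k i 0 = \<delta> (T_iter \<sigma> \<delta> f h k (i - 1) 0)
          \<and> (\<forall>j. 1 \<le> j \<and> j \<le> n - 2 \<longrightarrow>
               T_iter \<sigma> \<delta> f h k i j =
                 \<delta> (T_iter \<sigma> \<delta> f h k (i - 1) j) + \<sigma> (T_iter \<sigma> \<delta> f h k (i - 1) (j - 1))))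
    \<and> (\<forall>i. n - k \<le> i \<and> i \<le> n - 1 \<longrightarrow>
          T_iter \<sigma> \<delta> f h k i 0 =
            \<delta> (T_iter \<sigma> \<delta> f h k (i - 1) 0) - \<sigma> (T_iter \<sigma> \<delta> f h k (i - 1) (n - 1)) * coeff f 0
          \<and> (\<forall>j. 1 \<le> j \<and> j \<le> n - 1 \<longrightarrow>
               T_iter \<sigma> \<delta> f h k i j =
                 \<delta> (T_iter \<sigma> \<delta> f h k (i - 1) j) + \<sigma> (T_iter \<sigma> \<delta> f h k (i - 1) (j - 1))
                 - \<sigma> (T_iter \<sigma> \<delta> f h k (i - 1) (n - 1)) * coeff f j))"
proof -
  interpret skew_data \<sigma> \<delta> by fact
  note n = \<open>degree f = n\<close> and k = \<open>k < n\<close> and h = \<open>degree h \<le> k\<close>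
  have "is_control_matrix n n (staircase_matrix \<sigma> \<delta> f h k) C"
    using staircase_matrix_is_control_matrix[of f g h k] assms regular by simp
  moreover have "T_iter \<sigma> \<delta> f h k 0 i = 0" if "k + 1 \<le> i" "i \<le> n - 1" for i
    using that k n h by (simp add: T_iter_unreduced coeff_eq_0)
  moreover have rec: "T_iter \<sigma> \<delta> f h k i j =
      (case j of 0 \<Rightarrow> 0 | Suc j' \<Rightarrow> \<sigma> (T_iter \<sigma> \<delta> f h k (i - 1) j')) + \<delta> (T_iter \<sigma> \<delta> f h k (i - 1) j)
        - \<sigma> (T_iter \<sigma> \<delta> f h k (i - 1) (n - 1)) * coeff f j" if "1 \<le> i" "j < n" for i j
    using T_iter_Suc[of j f h k "i - 1"] that n by simp
  moreover have last: "T_iter \<sigma> \<delta> f h k (i - 1) (n - 1) = 0" if "1 \<le> i" "i \<le> n - k - 1" for i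
  proof -
    have "k + (i - 1) < n - 1" using that k by linarith
    then show ?thesis
      using n skew_X_pow_top(1)[OF h, of "i - 1"] by (simp add: T_iter_unreduced[OF h] coeff_eq_0)
  qed
  ultimately show ?thesis
    using k by (auto simp: hom_zero split: nat.split)
qed

end
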